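(* Let $A$ and $B$ be stable matching instances on workers $\mathcal{W}$ and firms $\mathcal{F}=\{f_1,\dots,f_n\}$ in which every worker has the same preference list in $A$ as in $B$. For $i=1,\dots,n$ let $B_i$ be the instance in which firm $f_i$ has its preference list from $B$ and every other agent has its preference list from $A$. Then $\mathcal{M}_A\cap\mathcal{M}_B=\mathcal{M}_A\cap\mathcal{M}_{B_1}\cap\mathcal{M}_{B_2}\cap\cdots\cap\mathcal{M}_{B_n}$.
   Context: In a stable matching instance each agent strictly totally orders the agents of the other side; a perfect matching $M$ is stable under $I$ if no pair $(w,f)\notin M$ has $w$ preferring $f$ to $M(w)$ and $f$ preferring $w$ to $M(f)$ under $I$; $\mathcal{M}_I$ is the set of perfect matchings stable under $I$. *)

theory Defs
  imports Main
begin

text \<open>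
  A pair \<open>(x, y)\<close> in \<open>worker_pref I w\<close> (or \<open>firm_pref I f\<close>) means that the agent strictly
  prefers \<open>x\<close> to \<open>y\<close>.
\<close>

record ('w, 'f) prefs =
  worker_pref :: "'w \<Rightarrow> 'f rel"
  firm_pref :: "'f \<Rightarrow> 'w rel"

text \<open>
  Preference relations are confined to the other side of the market, so that two agents have
  the same preference list iff their relations are equal.
\<close>

definition preference_on :: "'a set \<Rightarrow> 'a rel \<Rightarrow> bool" where
  "preference_on X r \<longleftrightarrow> r \<subseteq> X \<times> X \<and> strict_linear_order_on X r"

definition stable_matching_instance :: "'w set \<Rightarrow> 'f set \<Rightarrow> ('w, 'f) prefs \<Rightarrow> bool" where
  "stable_matching_instance W F I \<longleftrightarrow>
     finite W \<and> finite F \<and>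
     (\<forall>w\<in>W. preference_on F (worker_pref I w)) \<and>
     (\<forall>f\<in>F. preference_on W (firm_pref I f))"

definition perfect_matching :: "'w set \<Rightarrow> 'f set \<Rightarrow> ('w \<times> 'f) set \<Rightarrow> bool" where
  "perfect_matching W F M \<longleftrightarrow>
     M \<subseteq> W \<times> F \<and>
     (\<forall>w\<in>W. \<exists>!f. (w, f) \<in> M) \<and>
     (\<forall>f\<in>F. \<exists>!w. (w, f) \<in> M)"

definition firm_of :: "('w \<times> 'f) set \<Rightarrow> 'w \<Rightarrow> 'f" where
  "firm_of M w = (THE f. (w, f) \<in> M)"

definition worker_of :: "('w \<times> 'f) set \<Rightarrow> 'f \<Rightarrow> 'w" where
  "worker_of M f = (THE w. (w, f) \<in> M)"

definition blocking_pair ::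
    "('w, 'f) prefs \<Rightarrow> ('w \<times> 'f) set \<Rightarrow> 'w \<Rightarrow> 'f \<Rightarrow> bool" where
  "blocking_pair I M w f \<longleftrightarrow>
     (w, f) \<notin> M \<and>
     (f, firm_of M w) \<in> worker_pref I w \<and>
     (w, worker_of M f) \<in> firm_pref I f"

definition stable_matchings ::
    "'w set \<Rightarrow> 'f set \<Rightarrow> ('w, 'f) prefs \<Rightarrow> ('w \<times> 'f) set set" where
  "stable_matchings W F I =
     {M. perfect_matching W F M \<and> \<not> (\<exists>w\<in>W. \<exists>f\<in>F. blocking_pair I M w f)}"

definition replace_firm_pref ::
    "('w, 'f) prefs \<Rightarrow> ('w, 'f) prefs \<Rightarrow> 'f \<Rightarrow> ('w, 'f) prefs" where
  "replace_firm_pref A B f = A\<lparr>firm_pref := (firm_pref A)(f := firm_pref B f)\<rparr>"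

end

theory Submission
  imports Defs
begin

text \<open>
  Whether \<open>(w, g)\<close> blocks a matching depends only on the preferences of \<open>w\<close> and \<open>g\<close>. Since the
  workers agree, a pair at the firm \<open>g\<close> blocks under \<open>B\<close> iff it blocks under the instance in
  which \<open>g\<close> alone has switched, whose remaining pairs block iff they block under \<open>A\<close>.
\<close>

lemma blocking_pair_replace_firm_pref:
  assumes "worker_pref A w = worker_pref B w"
  shows "blocking_pair (replace_firm_pref A B g) M w h \<longleftrightarrow>
    (if h = g then blocking_pair B M w h else blocking_pair A M w h)"
  using assms by (simp add: blocking_pair_def replace_firm_pref_def)

theorem theorem7:
  fixes W :: "'w set" and F :: "'f set" and A B :: "('w, 'f) prefs"
    and f :: "nat \<Rightarrow> 'f" and n :: nat
  assumes firms: "bij_betw f {1..n} F"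
    and A: "stable_matching_instance W F A"
    and B: "stable_matching_instance W F B"
    and same_workers: "\<forall>w\<in>W. worker_pref A w = worker_pref B w"
  shows "stable_matchings W F A \<inter> stable_matchings W F B =
    stable_matchings W F A \<inter> (\<Inter>i\<in>{1..n}. stable_matchings W F (replace_firm_pref A B (f i)))"
proof -
  have "M \<in> stable_matchings W F B \<longleftrightarrow>
      (\<forall>g\<in>F. M \<in> stable_matchings W F (replace_firm_pref A B g))"
    if M: "M \<in> stable_matchings W F A" for M
  proof -
    have stable: "\<not> blocking_pair A M w g" if "w \<in> W" "g \<in> F" for w g
      using M that unfolding stable_matchings_def by blast
    have perfect: "perfect_matching W F M"
      using M unfolding stable_matchings_def by blast
    \<comment> \<open>For \<open>h\<close> other than \<open>g\<close> the pair would have to block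
      under \<open>A\<close>, which \<open>stable\<close> rules out; only pairs at the switched firm
      survive.\<close>
    have "blocking_pair (replace_firm_pref A B g) M w h \<longleftrightarrow> h = g \<and> blocking_pair B M w g"
      if "w \<in> W" "h \<in> F" for w g h
      using that stable same_workers by (simp add: blocking_pair_replace_firm_pref)
    \<comment> \<open>Perfection ignores preferences, so only blocking pairs matter: one under
      \<open>B\<close> at a firm \<open>h\<close> is detected by taking \<open>g\<close> to be
      \<open>h\<close>.\<close>
    then show ?thesis
      using perfect unfolding stable_matchings_def by blast
  qed
  \<comment> \<open>For empty \<open>F\<close> the intersection is \<open>UNIV\<close>, matching the
    vacuous quantifier over \<open>g\<close>.\<close>
  then have "stable_matchings W F A \<inter> stable_matchings W F B =
      stable_matchings W F A \<inter> (\<Inter>g\<in>F. stable_matchings W F (replace_firm_pref A B g))"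
    by blast
  also have "(\<Inter>g\<in>F. stable_matchings W F (replace_firm_pref A B g)) =
      (\<Inter>i\<in>{1..n}. stable_matchings W F (replace_firm_pref A B (f i)))"
    using bij_betw_imp_surj_on[OF firms] by (metis image_image)
  finally show ?thesis .
qed

end
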